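(* Let $K, L \subset \mathbb{R}^n$ be convex bodies (with nonempty interior), $P$ a symmetric positive-definite $n \times n$ matrix, and $z \in \mathbb{R}^n$. Then the body $L' = PL+z$ is the positive John image of $L$ in $K$ if and only if $P^{1/2}L + P^{-1/2}z$ is in positive John position inside $P^{-1/2}K$.
   Context: A convex body is a compact convex set with nonempty interior. $\mathcal{P}^n$ is the set of symmetric positive-definite $n\times n$ real matrices; $P^{1/2}$ is the unique positive-definite square root of $P\in\mathcal{P}^n$ and $P^{-1/2}$ its inverse. A positive image of $L$ in $K$ is a set $QL+w$ contained in $K$ with $Q\in\mathcal{P}^n$, $w\in\mathbb{R}^n$. The positive John image of $L$ in $K$ is the unique positive image of $L$ in $K$ of maximal volume. $L$ is in positive John position inside $K$ if $L\subset K$ and $L$ has maximal volume among all positive images of $L$ contained in $K$ (i.e. the positive John image of $L$ in $K$ is $L$ itself). *)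

theory Defs
  imports "HOL-Analysis.Analysis"
begin

definition convex_body :: "(real ^ 'n) set \<Rightarrow> bool" where
  "convex_body K \<longleftrightarrow> compact K \<and> convex K \<and> interior K \<noteq> {}"

definition pos_def :: "real ^ 'n ^ 'n \<Rightarrow> bool" where
  "pos_def A \<longleftrightarrow> transpose A = A \<and> (\<forall>x. x \<noteq> 0 \<longrightarrow> 0 < x \<bullet> (A *v x))"

definition pd_sqrt :: "real ^ 'n ^ 'n \<Rightarrow> real ^ 'n ^ 'n" where
  "pd_sqrt P = (THE R. pos_def R \<and> R ** R = P)"

definition pd_inv_sqrt :: "real ^ 'n ^ 'n \<Rightarrow> real ^ 'n ^ 'n" where
  "pd_inv_sqrt P = matrix_inv (pd_sqrt P)"

definition positive_image_in ::
    "(real ^ 'n) set \<Rightarrow> (real ^ 'n) set \<Rightarrow> (real ^ 'n) set \<Rightarrow> bool" where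
  "positive_image_in L K M \<longleftrightarrow>
     (\<exists>Q w. pos_def Q \<and> M = (\<lambda>x. Q *v x + w) ` L) \<and> M \<subseteq> K"

definition max_positive_image_in ::
    "(real ^ 'n) set \<Rightarrow> (real ^ 'n) set \<Rightarrow> (real ^ 'n) set \<Rightarrow> bool" where
  "max_positive_image_in L K M \<longleftrightarrow>
     positive_image_in L K M \<and>
     (\<forall>N. positive_image_in L K N \<longrightarrow> measure lebesgue N \<le> measure lebesgue M)"

text \<open>Here \<open>M\<close> is the positive John image of \<open>L\<close> in \<open>K\<close>. Uniqueness of the maximiser,
  as a set, is part of the definition.\<close>

definition positive_John_image ::
    "(real ^ 'n) set \<Rightarrow> (real ^ 'n) set \<Rightarrow> (real ^ 'n) set \<Rightarrow> bool" where
  "positive_John_image L K M \<longleftrightarrow>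
     max_positive_image_in L K M \<and> (\<forall>N. max_positive_image_in L K N \<longrightarrow> N = M)"

text \<open>Here \<open>L\<close> is in positive John position inside \<open>K\<close>. Only maximality is demanded;
  for convex bodies uniqueness of the maximiser is a theorem.\<close>

definition positive_John_position :: "(real ^ 'n) set \<Rightarrow> (real ^ 'n) set \<Rightarrow> bool" where
  "positive_John_position L K \<longleftrightarrow>
     L \<subseteq> K \<and>
     (\<forall>N. positive_image_in L K N \<longrightarrow> measure lebesgue N \<le> measure lebesgue L)"

end

theory Submission
  imports Defs
begin

text \<open>The linear map \<open>x \<mapsto> P\<^sup>-\<^sup>1\<^sup>/\<^sup>2 x\<close> carries positive images of \<open>L\<close> in \<open>K\<close> to positive images of
  \<open>P\<^sup>1\<^sup>/\<^sup>2 L + P\<^sup>-\<^sup>1\<^sup>/\<^sup>2 z\<close> in \<open>P\<^sup>-\<^sup>1\<^sup>/\<^sup>2 K\<close>, because \<open>Q \<mapsto> P\<^sup>-\<^sup>1\<^sup>/\<^sup>2 Q P\<^sup>-\<^sup>1\<^sup>/\<^sup>2\<close> preserves positive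
  definiteness; it scales all volumes by the same factor, so maximality transfers. That a maximiser is
  unique follows from the strict AM-GM inequality for the determinant: the average of two maximal images
  with different linear parts is larger, and between two distinct translates of one image there is
  room to stretch it in the direction of the translation.\<close>

subsection \<open>Volume of linear images\<close>

text \<open>The library's \<open>measure_linear_image\<close> requires a well-ordered index type, so it is
  transferred to arbitrary finite index types along an enumeration.\<close>

typedef 'n initial_segment = "{..<CARD('n::finite)}"
  by (rule exI[of _ 0]) simp

instance initial_segment :: (finite) finite
proof
  have "finite (Abs_initial_segment ` {..<CARD('a)} :: 'a initial_segment set)"
    by simp
  also have "Abs_initial_segment ` {..<CARD('a)} = (UNIV :: 'a initial_segment set)"
    using type_definition.Abs_image[OF type_definition_initial_segment] by simp
  finally show "finite (UNIV :: 'a initial_segment set)" .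
qed

instantiation initial_segment :: (finite) linorder
begin
definition "x \<le> y \<longleftrightarrow> Rep_initial_segment x \<le> Rep_initial_segment y"
definition "x < y \<longleftrightarrow> Rep_initial_segment x < Rep_initial_segment y"
instance
  by intro_classes
    (auto simp: less_eq_initial_segment_def less_initial_segment_def Rep_initial_segment_inject)
end

instance initial_segment :: (finite) wellorder
proof -
  have "{(x :: 'a initial_segment, y). x < y} = inv_image less_than Rep_initial_segment"
    by (auto simp: less_initial_segment_def)
  then have "wf {(x :: 'a initial_segment, y). x < y}"
    by simp
  then show "OFCLASS('a initial_segment, wellorder_class)"
    by (rule wf_wellorderI) intro_classes
qed

lemma card_initial_segment: "CARD('n::finite initial_segment) = CARD('n)"
  using type_definition.card[OF type_definition_initial_segment] by simp

section \<open>Determinant and Lebesgue measure under relabelling of coordinates\<close>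

text \<open>Conjugation by \<open>g\<close> is a sign-preserving bijection between the permutations
  of the two index types, so the Leibniz sums agree term by term.\<close>

lemma det_reindex:
  fixes A :: "'a::comm_ring_1 ^ 'n ^ 'n" and g :: "'m::finite \<Rightarrow> 'n"
  assumes g: "bij g"
  shows "det (\<chi> i j. A $ g i $ g j) = det A"
proof -
  let ?F = "map_permutation UNIV g"
  have ginv: "bij_betw (inv g) UNIV UNIV"
    using g by (simp add: bij_imp_bij_inv)
  have bij: "bij_betw ?F {p. p permutes UNIV} {p. p permutes UNIV}"
  proof (rule bij_betw_byWitness[where f' = "map_permutation UNIV (inv g)"])
    show "\<forall>p\<in>{p. p permutes UNIV}. map_permutation UNIV (inv g) (?F p) = p"
      using g ginv by (auto intro!: map_permutation_compose_inv[where A=UNIV and B=UNIV] simp: bij_is_inj)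
    show "\<forall>p\<in>{p. p permutes UNIV}. ?F (map_permutation UNIV (inv g) p) = p"
      using g ginv
      by (auto intro!: map_permutation_compose_inv[where A=UNIV and B=UNIV] simp: bij_is_surj surj_f_inv_f)
  qed (use g ginv in \<open>auto intro!: map_permutation_permutes\<close>)
  have "det A = (\<Sum>p\<in>{p. p permutes UNIV}. of_int (sign (?F p)) * (\<Prod>i\<in>UNIV. A $ i $ ?F p i))"
    unfolding det_def by (rule sum.reindex_bij_betw[OF bij, symmetric])
  also have "\<dots> = (\<Sum>p\<in>{p. p permutes UNIV}. of_int (sign p) * (\<Prod>i\<in>UNIV. A $ g i $ g (p i)))"
  proof (rule sum.cong[OF refl])
    fix p :: "'m \<Rightarrow> 'm" assume p: "p \<in> {p. p permutes UNIV}"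
    have "(\<Prod>i\<in>UNIV. A $ i $ ?F p i) = (\<Prod>i\<in>UNIV. A $ g i $ ?F p (g i))"
      using prod.reindex_bij_betw[OF g, of "\<lambda>i. A $ i $ ?F p i"] by simp
    also have "\<dots> = (\<Prod>i\<in>UNIV. A $ g i $ g (p i))"
      using g by (simp add: map_permutation_apply bij_is_inj)
    finally show "of_int (sign (?F p)) * (\<Prod>i\<in>UNIV. A $ i $ ?F p i) =
        of_int (sign p) * (\<Prod>i\<in>UNIV. A $ g i $ g (p i))"
      using p g by (simp add: sign_map_permutation bij_is_inj)
  qed
  finally show ?thesis
    by (simp add: det_def)
qed

lemma prod_Basis_cart: "(\<Prod>b\<in>Basis. (x :: real ^ 'n) \<bullet> b) = (\<Prod>i\<in>UNIV. x $ i)"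
proof -
  have "Basis = (\<lambda>i. axis i (1::real)) ` (UNIV :: 'n set)"
    by (auto simp: Basis_vec_def)
  moreover have "inj (\<lambda>i :: 'n. axis i (1::real))"
    by (auto simp: inj_on_def axis_eq_axis)
  ultimately have "(\<Prod>b\<in>Basis. x \<bullet> b) = (\<Prod>i\<in>UNIV. x \<bullet> axis i 1)"
    using prod.reindex[of "\<lambda>i. axis i (1::real)" UNIV "\<lambda>b. x \<bullet> b"] by (simp add: o_def)
  then show ?thesis
    by (simp add: inner_axis)
qed

text \<open>Lebesgue measure is determined by its values on open boxes. Relabelling pulls a box back
  to a box with the same side lengths in another order.\<close>

lemma distr_lborel_reindex:
  fixes g :: "'n::finite \<Rightarrow> 'm::finite"
  assumes g: "bij g"
  shows "distr lborel borel (\<lambda>x :: real ^ 'm. \<chi> i. x $ g i) = lborel"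
proof (rule lborel_eqI[symmetric])
  let ?h = "\<lambda>x :: real ^ 'm. \<chi> i. x $ g i" and ?k = "\<lambda>x :: real ^ 'n. \<chi> i. x $ inv g i"
  have cont: "continuous_on UNIV ?h"
    by (intro continuous_intros)
  fix l u :: "real ^ 'n"
  assume le: "\<And>b. b \<in> Basis \<Longrightarrow> l \<bullet> b \<le> u \<bullet> b"
  have le': "l $ i \<le> u $ i" for i
    using le[of "axis i 1"] by (auto simp: Basis_vec_def inner_axis)
  have vim: "?h -` box l u = box (?k l) (?k u)"
  proof (intro set_eqI)
    fix x
    have "(\<forall>i. l $ i < x $ g i \<and> x $ g i < u $ i) \<longleftrightarrow>
      (\<forall>j. l $ inv g j < x $ j \<and> x $ j < u $ inv g j)"
      using g by (metis bij_inv_eq_iff)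
    then show "x \<in> ?h -` box l u \<longleftrightarrow> x \<in> box (?k l) (?k u)"
      by (simp add: mem_box_cart)
  qed
  have "emeasure (distr lborel borel ?h) (box l u) = emeasure lborel (box (?k l) (?k u))"
    using cont by (subst emeasure_distr) (auto simp: borel_measurable_continuous_onI vim)
  also have "\<dots> = (\<Prod>b\<in>Basis. (?k u - ?k l) \<bullet> b)"
    by (rule emeasure_lborel_box) (auto simp: Basis_vec_def inner_axis le')
  also have "(\<Prod>b\<in>Basis. (?k u - ?k l) \<bullet> b) = (\<Prod>j\<in>UNIV. (u - l) $ inv g j)"
    by (simp add: prod_Basis_cart)
  also have "\<dots> = (\<Prod>b\<in>Basis. (u - l) \<bullet> b)"
    unfolding prod_Basis_cart
    using prod.reindex_bij_betw[OF bij_imp_bij_inv[OF g], of "\<lambda>i. (u - l) $ i"] by simp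
  finally show "emeasure (distr lborel borel ?h) (box l u) = (\<Prod>b\<in>Basis. (u - l) \<bullet> b)" .
qed simp

text \<open>Compact sets are Borel, so \<open>lebesgue\<close> and \<open>lborel\<close> agree on
  them and \<open>distr_lborel_reindex\<close> applies; injectivity makes the preimage of the image
  equal to \<open>S\<close>.\<close>

lemma measure_lebesgue_reindex:
  fixes g :: "'n::finite \<Rightarrow> 'm::finite" and S :: "(real ^ 'm) set"
  assumes g: "bij g" and S: "compact S"
  shows "measure lebesgue ((\<lambda>x. \<chi> i. x $ g i) ` S) = measure lebesgue S"
proof -
  let ?h = "\<lambda>x :: real ^ 'm. \<chi> i. x $ g i"
  have cont: "continuous_on X ?h" for X
    by (intro continuous_intros)
  have inj: "inj ?h"
    by (rule injI) (simp add: vec_eq_iff, metis g bij_pointE)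
  have comp: "compact (?h ` S)"
    using S cont by (rule compact_continuous_image[rotated])
  have "measure lebesgue (?h ` S) = measure (distr lborel borel ?h) (?h ` S)"
    using comp by (simp add: distr_lborel_reindex[OF g] borel_compact)
  also have "\<dots> = measure lborel S"
    using comp cont inj
    by (subst measure_distr) (auto simp: borel_measurable_continuous_onI borel_compact inj_vimage_image_eq)
  finally show ?thesis
    using S by (simp add: borel_compact)
qed

text \<open>Multiplication by \<open>A\<close> factors into relabelling by \<open>g\<close>,
  multiplication by the reindexed matrix, and relabelling back. The outer maps preserve volume, the
  middle one acts over a well-ordered index type, and its determinant is
  \<open>det A\<close>.\<close>

lemma measure_matrix_image:
  fixes A :: "real ^ 'n ^ 'n"
  assumes S: "compact S"
  shows "measure lebesgue ((*v) A ` S) = \<bar>det A\<bar> * measure lebesgue S"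
proof -
  obtain g :: "'n initial_segment \<Rightarrow> 'n" where g: "bij g"
    using finite_same_card_bij[of "UNIV :: 'n initial_segment set" "UNIV :: 'n set"]
      card_initial_segment by auto
  let ?A = "\<chi> i j. A $ g i $ g j"
  let ?h = "\<lambda>x :: real ^ 'n initial_segment. \<chi> i. x $ inv g i"
  let ?k = "\<lambda>x :: real ^ 'n. \<chi> i. x $ g i"
  have comp: "A *v x = ?h (?A *v ?k x)" for x
  proof -
    have "(\<Sum>j\<in>UNIV. A $ i $ j * x $ j) = (\<Sum>j\<in>UNIV. A $ i $ g j * x $ g j)" for i
      using sum.reindex_bij_betw[OF g, of "\<lambda>j. A $ i $ j * x $ j"] by simp
    then show ?thesis
      using g by (simp add: vec_eq_iff matrix_vector_mult_def bij_is_surj surj_f_inv_f)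
  qed
  have k: "compact (?k ` S)"
    by (intro compact_continuous_image S continuous_intros)
  then have Ak: "compact ((*v) ?A ` ?k ` S)"
    by (rule compact_continuous_image[rotated]) (simp add: linear_continuous_on)
  have "(*v) A ` S = ?h ` (*v) ?A ` ?k ` S"
    by (simp add: image_image flip: comp)
  then have "measure lebesgue ((*v) A ` S) = measure lebesgue ((*v) ?A ` ?k ` S)"
    using measure_lebesgue_reindex[OF bij_imp_bij_inv[OF g] Ak] by simp
  also have "\<dots> = \<bar>det ?A\<bar> * measure lebesgue (?k ` S)"
    using k by (subst measure_linear_image) (auto simp: lmeasurable_compact)
  finally show ?thesis
    by (simp add: det_reindex[OF g] measure_lebesgue_reindex[OF g S])
qed

subsection \<open>Symmetric and positive definite matrices\<close>

text \<open>The quadratic form \<open>x \<bullet> f x\<close> attains its maximum on the compact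
  unit sphere of \<open>S\<close>. A maximiser is an eigenvector, since otherwise moving it along
  the residual \<open>f v - l v\<close> would increase the Rayleigh quotient.\<close>

lemma selfadjoint_eigenvector:
  fixes f :: "'a::euclidean_space \<Rightarrow> 'a"
  assumes f: "linear f" and sa: "\<And>x y. f x \<bullet> y = x \<bullet> f y"
    and S: "subspace S" "f ` S \<subseteq> S" "S \<noteq> {0}"
  obtains v where "v \<in> S" "norm v = 1" "f v = (v \<bullet> f v) *\<^sub>R v"
proof -
  have "0 \<in> S"
    using S(1) by (rule subspace_0)
  with S(3) obtain a where a: "a \<in> S" "a \<noteq> 0"
    by blast
  have "sphere 0 1 \<inter> S \<noteq> {}"
    using a S(1) by (auto intro!: exI[of _ "a /\<^sub>R norm a"] simp: subspace_scale disjoint_iff)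
  moreover have "compact (sphere 0 1 \<inter> S)"
    using S(1) by (intro compact_Int_closed compact_sphere closed_subspace)
  moreover have "continuous_on (sphere 0 1 \<inter> S) (\<lambda>x. x \<bullet> f x)"
    using f by (intro continuous_intros linear_continuous_on) (simp add: linear_conv_bounded_linear)
  ultimately obtain v where v: "v \<in> sphere 0 1 \<inter> S"
    and max: "\<And>x. x \<in> sphere 0 1 \<inter> S \<Longrightarrow> x \<bullet> f x \<le> v \<bullet> f v"
    using continuous_attains_sup by metis
  define l where "l = v \<bullet> f v"
  have vv: "v \<bullet> v = 1"
    using v by (simp add: dot_square_norm)
  have rayleigh: "x \<bullet> f x \<le> l * (x \<bullet> x)" if x: "x \<in> S" for x
  proof (cases "x = 0")
    case False
    have "(x /\<^sub>R norm x) \<bullet> f (x /\<^sub>R norm x) \<le> l"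
      unfolding l_def using False x S(1) by (intro max) (auto simp: subspace_scale)
    then have "(x \<bullet> f x) / (norm x)\<^sup>2 \<le> l"
      by (simp add: linear_scale[OF f] power2_eq_square divide_simps)
    then show ?thesis
      using False by (simp add: divide_le_eq dot_square_norm)
  qed simp
  define w where "w = f v - l *\<^sub>R v"
  have wS: "w \<in> S"
    unfolding w_def using v S by (auto intro!: subspace_diff subspace_scale)
  define c where "c = l * (w \<bullet> w) - w \<bullet> f w"
  \<comment> \<open>This is the Rayleigh bound at \<open>v + t w\<close>. The terms of order zero
    cancel, the first-order terms leave \<open>2 t (w \<bullet> w)\<close>, and \<open>c\<close>
    collects the second-order ones.\<close>
  have quad: "2 * t * (w \<bullet> w) \<le> t\<^sup>2 * c" for t
  proof -
    have "(v + t *\<^sub>R w) \<bullet> f (v + t *\<^sub>R w) \<le> l * ((v + t *\<^sub>R w) \<bullet> (v + t *\<^sub>R w))"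
      using v wS S(1) by (intro rayleigh) (auto intro!: subspace_add subspace_scale)
    moreover have "(v + t *\<^sub>R w) \<bullet> f (v + t *\<^sub>R w) = l + 2 * t * (w \<bullet> f v) + t\<^sup>2 * (w \<bullet> f w)"
      using sa[of v w] by (simp add: linear_add[OF f] linear_scale[OF f] inner_add_left inner_add_right
          l_def power2_eq_square inner_commute[of "f v"] algebra_simps)
    moreover have "(v + t *\<^sub>R w) \<bullet> (v + t *\<^sub>R w) = 1 + 2 * t * (w \<bullet> v) + t\<^sup>2 * (w \<bullet> w)"
      using vv by (simp add: inner_add_left inner_add_right power2_eq_square inner_commute algebra_simps)
    moreover have "w \<bullet> w = w \<bullet> f v - l * (w \<bullet> v)"
      by (simp add: w_def inner_diff_right)
    ultimately have "l + 2 * t * (w \<bullet> f v) + t\<^sup>2 * (w \<bullet> f w)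
        \<le> l * (1 + 2 * t * (w \<bullet> v) + t\<^sup>2 * (w \<bullet> w))"
      and wf: "w \<bullet> f v = w \<bullet> w + l * (w \<bullet> v)"
      by simp_all
    then show ?thesis
      unfolding c_def wf by (simp add: algebra_simps)
  qed
  have "w = 0"
  proof (rule ccontr)
    assume "w \<noteq> 0"
    then have ww: "w \<bullet> w > 0" by simp
    have c: "c \<ge> 0"
      using rayleigh[OF wS] by (simp add: c_def)
    \<comment> \<open>Small enough for the linear term to beat the quadratic one; the
      \<open>+ 1\<close> keeps the denominator positive when \<open>c = 0\<close>.\<close>
    define t where "t = (w \<bullet> w) / (c + 1)"
    have t: "t > 0" using ww c by (simp add: t_def)
    have "2 * (w \<bullet> w) \<le> t * c"
      using quad[of t] t by (simp add: power2_eq_square)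
    also have "\<dots> \<le> t * (c + 1)" using t by simp
    also have "\<dots> = w \<bullet> w" using c by (simp add: t_def)
    finally show False using ww by simp
  qed
  then show thesis
    using that[of v] v by (simp add: w_def l_def)
qed

text \<open>An orthonormal set of eigenvectors of largest cardinality must span: its orthogonal
  complement is invariant under \<open>f\<close>, so a nonzero complement would contain a further
  unit eigenvector.\<close>

lemma selfadjoint_eigenbasis:
  fixes f :: "'a::euclidean_space \<Rightarrow> 'a"
  assumes f: "linear f" and sa: "\<And>x y. f x \<bullet> y = x \<bullet> f y"
  obtains B where "pairwise orthogonal B" "card B = DIM('a)"
    "\<And>b. b \<in> B \<Longrightarrow> norm b = 1" "\<And>b. b \<in> B \<Longrightarrow> f b = (b \<bullet> f b) *\<^sub>R b"
proof -
  define E where "E B \<longleftrightarrow> pairwise orthogonal B \<and> (\<forall>b\<in>B. norm b = 1 \<and> f b = (b \<bullet> f b) *\<^sub>R b)"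
    for B
  have indep: "independent B" if "E B" for B
    using that by (intro pairwise_orthogonal_independent) (auto simp: E_def)
  have bound: "card B \<le> DIM('a)" if "E B" for B
    using independent_bound[OF indep[OF that]] by simp
  have "E {}"
    by (simp add: E_def)
  then obtain B where B: "E B" and max: "\<And>C. E C \<Longrightarrow> card C \<le> card B"
    using ex_has_greatest_nat[of E "{}" card "Suc DIM('a)"] bound by (auto simp: less_Suc_eq_le)
  have fin: "finite B"
    using independent_bound[OF indep[OF B]] by simp
  define S where "S = {x. \<forall>b\<in>B. orthogonal b x}"
  have "S = {0}"
  proof (rule ccontr)
    assume ne: "S \<noteq> {0}"
    have sub: "subspace S"
      unfolding S_def by (rule subspace_orthogonal_to_vectors)
    have "b \<bullet> f x = 0" if "x \<in> S" "b \<in> B" for x b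
    proof -
      have "b \<bullet> f x = f b \<bullet> x"
        by (simp add: sa)
      also have "f b = (b \<bullet> f b) *\<^sub>R b"
        using B that by (simp add: E_def)
      finally show ?thesis
        using that by (simp add: S_def orthogonal_def)
    qed
    then have "f ` S \<subseteq> S"
      by (auto simp: S_def orthogonal_def)
    then obtain v where v: "v \<in> S" "norm v = 1" "f v = (v \<bullet> f v) *\<^sub>R v"
      using selfadjoint_eigenvector[OF f sa sub _ ne] by blast
    have "v \<notin> B"
      using v by (auto simp: S_def orthogonal_def norm_eq_1)
    moreover have "E (insert v B)"
      using B v by (auto simp: E_def pairwise_insert S_def orthogonal_commute)
    ultimately show False
      using max[of "insert v B"] fin by simp
  qed
  have "span B = UNIV"
  proof (rule ccontr)
    assume "span B \<noteq> UNIV"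
    then obtain a where "a \<noteq> 0" "\<And>x. x \<in> span B \<Longrightarrow> orthogonal a x"
      using orthogonal_to_subspace_exists_gen[of B UNIV] by (auto simp: psubset_eq)
    then show False
      using \<open>S = {0}\<close> by (auto simp: S_def orthogonal_commute span_base)
  qed
  then have "card B = DIM('a)"
    using indep[OF B] by (metis dim_UNIV dim_eq_card_independent dim_span)
  with B show thesis
    by (intro that[of B]) (auto simp: E_def)
qed

section \<open>Diagonal matrices and orthogonal diagonalization\<close>

definition diag_matrix :: "('n \<Rightarrow> 'a::zero) \<Rightarrow> 'a ^ 'n ^ 'n" where
  "diag_matrix d = (\<chi> i j. if i = j then d i else 0)"

lemma diag_matrix_vector: "diag_matrix d *v x = (\<chi> i. d i * x $ i)"
  by (simp add: diag_matrix_def matrix_vector_mult_def if_distrib[of "\<lambda>a. a * _"] cong: if_cong)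

lemma diag_matrix_mult: "diag_matrix d ** diag_matrix e = diag_matrix (\<lambda>i. d i * e i)"
  by (simp add: matrix_eq diag_matrix_vector mult.assoc flip: matrix_vector_mul_assoc)

lemma diag_matrix_one: "diag_matrix (\<lambda>_. 1) = mat 1"
  by (simp add: diag_matrix_def mat_def)

lemma diag_matrix_add:
  "diag_matrix d + diag_matrix e = (diag_matrix (\<lambda>i. d i + e i) :: 'a::monoid_add ^ 'n ^ 'n)"
  by (simp add: diag_matrix_def vec_eq_iff)

lemma transpose_diag_matrix: "transpose (diag_matrix d) = diag_matrix d"
  by (auto simp: diag_matrix_def transpose_def vec_eq_iff)

lemma det_diag_matrix: "det (diag_matrix d :: 'a::comm_ring_1 ^ 'n ^ 'n) = (\<Prod>i\<in>UNIV. d i)"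
  by (subst det_diagonal) (auto simp: diag_matrix_def)

lemma inner_matrix_vector: "x \<bullet> (A *v y) = (transpose A *v x) \<bullet> (y :: real ^ 'n)"
  for A :: "real ^ 'n ^ 'm"
  by (simp add: dot_lmul_matrix)

text \<open>The rows of \<open>U\<close> are an orthonormal eigenbasis enumerated by the index type;
  the eigenvalue equations, read column by column, say that
  \<open>A ** transpose U = transpose U ** diag_matrix d\<close>.\<close>

lemma symmetric_matrix_diagonalization:
  fixes A :: "real ^ 'n ^ 'n"
  assumes A: "transpose A = A"
  obtains U d where "orthogonal_matrix U" "A = transpose U ** diag_matrix d ** U"
proof -
  obtain B where B: "pairwise orthogonal B" "card B = CARD('n)"
    "\<And>b. b \<in> B \<Longrightarrow> norm b = 1" and eig: "\<And>b. b \<in> B \<Longrightarrow> A *v b = (b \<bullet> (A *v b)) *\<^sub>R b"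
    using selfadjoint_eigenbasis[of "(*v) A"] A inner_matrix_vector[of _ A]
    by (metis DIM_cart DIM_real matrix_vector_mul_linear mult.right_neutral)
  have "finite B"
    using B(2) by (simp add: card_ge_0_finite)
  then obtain b where b: "bij_betw b (UNIV :: 'n set) B"
    using B(2) by (metis finite_class.finite_UNIV finite_same_card_bij)
  have bB: "b i \<in> B" for i
    using b by (auto simp: bij_betw_def)
  define U :: "real ^ 'n ^ 'n" where "U = (\<chi> i. b i)"
  define d where "d i = b i \<bullet> (A *v b i)" for i
  have row: "row i U = b i" for i
    by (simp add: U_def row_def vec_eq_iff)
  have orth: "orthogonal_matrix U"
    unfolding orthogonal_matrix_orthonormal_rows row
    using B(1,3) b bB by (auto simp: pairwise_def bij_betw_def inj_on_def; metis)
  have "A ** transpose U = transpose U ** diag_matrix d"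
  proof -
    have "(A ** transpose U) $ i $ j = (transpose U ** diag_matrix d) $ i $ j" for i j
    proof -
      have "(A ** transpose U) $ i $ j = (A *v b j) $ i"
        by (simp add: matrix_matrix_mult_def matrix_vector_mult_def transpose_def U_def)
      also have "\<dots> = d j * b j $ i"
        using arg_cong[OF eig[OF bB], of "\<lambda>x. x $ i"] by (simp add: d_def)
      also have "\<dots> = (transpose U ** diag_matrix d) $ i $ j"
        by (simp add: matrix_matrix_mult_def transpose_def U_def diag_matrix_def
            if_distrib[of "\<lambda>a. _ * a"] cong: if_cong)
      finally show ?thesis .
    qed
    then show ?thesis
      by (simp add: vec_eq_iff)
  qed
  then have "A ** transpose U ** U = transpose U ** diag_matrix d ** U"
    by simp
  moreover have "A ** transpose U ** U = A"
    using orth by (simp add: orthogonal_matrix flip: matrix_mul_assoc)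
  ultimately show thesis
    using that orth by metis
qed

section \<open>Positive definite matrices under congruence, sums and inversion\<close>

lemma pos_def_congruence:
  fixes A M :: "real ^ 'n ^ 'n"
  assumes A: "pos_def A" and M: "invertible M"
  shows "pos_def (transpose M ** A ** M)"
  unfolding pos_def_def
proof (intro conjI allI impI)
  show "transpose (transpose M ** A ** M) = transpose M ** A ** M"
    using A by (simp add: pos_def_def matrix_transpose_mul matrix_mul_assoc)
  fix x :: "real ^ 'n" assume "x \<noteq> 0"
  then have "M *v x \<noteq> 0"
    using inj_matrix_vector_mult[OF M] by (metis injD matrix_vector_mult_0_right)
  then have "0 < (M *v x) \<bullet> (A *v (M *v x))"
    using A by (simp add: pos_def_def)
  then show "0 < x \<bullet> (transpose M ** A ** M *v x)"
    by (simp only: inner_matrix_vector[of x "transpose M"] transpose_transpose flip: matrix_vector_mul_assoc)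
qed

lemma orthogonal_imp_invertible: "orthogonal_matrix U \<Longrightarrow> invertible U"
  for U :: "real ^ 'n ^ 'n"
  by (auto simp: orthogonal_matrix_def invertible_def)

lemma pos_def_diag_matrix: "pos_def (diag_matrix d) \<longleftrightarrow> (\<forall>i. 0 < d i)"
proof
  assume "pos_def (diag_matrix d)"
  then have "0 < axis i 1 \<bullet> (diag_matrix d *v axis i 1)" for i
    by (auto simp: pos_def_def axis_eq_0_iff)
  then show "\<forall>i. 0 < d i"
    by (simp add: diag_matrix_vector inner_axis')
next
  assume d: "\<forall>i. 0 < d i"
  have "0 < x \<bullet> (diag_matrix d *v x)" if "x \<noteq> 0" for x
  proof -
    obtain k where "x $ k \<noteq> 0"
      using \<open>x \<noteq> 0\<close> by (auto simp: vec_eq_iff)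
    then have "0 < (\<Sum>i\<in>UNIV. d i * (x $ i)\<^sup>2)"
      using d by (intro sum_pos2[where i = k]) (auto simp: less_imp_le)
    also have "\<dots> = x \<bullet> (diag_matrix d *v x)"
      by (simp add: diag_matrix_vector inner_vec_def power2_eq_square mult_ac)
    finally show ?thesis .
  qed
  then show "pos_def (diag_matrix d)"
    by (simp add: pos_def_def transpose_diag_matrix)
qed

text \<open>The diagonal factor is itself congruent to \<open>A\<close>, hence positive definite,
  which forces positive entries.\<close>

lemma pos_def_diagonalization:
  assumes A: "pos_def A"
  obtains U d where "orthogonal_matrix U" "A = transpose U ** diag_matrix d ** U" "\<And>i. 0 < d i"
proof -
  obtain U d where U: "orthogonal_matrix U" and AU: "A = transpose U ** diag_matrix d ** U"
    using symmetric_matrix_diagonalization A by (metis pos_def_def)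
  have "transpose (transpose U) ** A ** transpose U = (U ** transpose U) ** diag_matrix d ** (U ** transpose U)"
    by (simp add: AU matrix_mul_assoc)
  also have "\<dots> = diag_matrix d"
    using U by (simp add: orthogonal_matrix_def)
  finally have "pos_def (diag_matrix d)"
    using pos_def_congruence[OF A, of "transpose U"] U by (simp add: orthogonal_imp_invertible)
  then show thesis
    using that U AU by (auto simp: pos_def_diag_matrix)
qed

lemma pos_def_det_pos: "pos_def A \<Longrightarrow> 0 < det A"
proof -
  assume "pos_def A"
  then obtain U d where U: "orthogonal_matrix U" and A: "A = transpose U ** diag_matrix d ** U"
    and d: "\<And>i. 0 < d i"
    using pos_def_diagonalization by blast
  have "det A = (det U)\<^sup>2 * (\<Prod>i\<in>UNIV. d i)"
    by (simp add: A det_mul det_diag_matrix power2_eq_square)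
  also have "(det U)\<^sup>2 = 1"
    using det_orthogonal_matrix[OF U] by auto
  finally show "0 < det A"
    using d by (simp add: prod_pos)
qed

lemma pos_def_invertible: "pos_def A \<Longrightarrow> invertible A"
  using pos_def_det_pos invertible_det_nz by (metis less_irrefl)

lemma matrix_inv_invertible:
  assumes "invertible A"
  shows "A ** matrix_inv A = mat 1" "matrix_inv A ** A = mat 1"
  using assms someI_ex[of "\<lambda>B. A ** B = mat 1 \<and> B ** A = mat 1"]
  by (auto simp: matrix_inv_def invertible_def)

lemma pos_def_add: "pos_def A \<Longrightarrow> pos_def B \<Longrightarrow> pos_def (A + B)"
  by (simp add: pos_def_def transpose_def vec_eq_iff matrix_vector_mult_add_rdistrib inner_add_right
      add_pos_pos)

lemma pos_def_scaleR: "pos_def A \<Longrightarrow> 0 < c \<Longrightarrow> pos_def (c *\<^sub>R A)"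
  by (simp add: pos_def_def transpose_scalar flip: scaleR_matrix_vector_assoc)

text \<open>Once \<open>B\<close> is known to be symmetric, \<open>B = transpose B ** A ** B\<close>
  exhibits it as a congruence of \<open>A\<close>.\<close>

lemma pos_def_inverse:
  assumes A: "pos_def A" and AB: "A ** B = mat 1"
  shows "pos_def B"
proof -
  have BA: "B ** A = mat 1"
    using AB by (simp add: matrix_left_right_inverse)
  have "transpose B = transpose B ** (A ** B)"
    using AB by simp
  also have "\<dots> = transpose (A ** B) ** B"
    using A by (simp add: matrix_transpose_mul pos_def_def matrix_mul_assoc)
  finally have "transpose B = B"
    using AB by simp
  moreover have "invertible B"
    using AB BA by (auto simp: invertible_def)
  ultimately show ?thesis
    using pos_def_congruence[OF A, of B] BA by simp
qed

section \<open>Existence and uniqueness of the positive definite square root\<close>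

lemma pos_def_sqrt_exists:
  assumes "pos_def A"
  shows "\<exists>R. pos_def R \<and> R ** R = A"
proof -
  obtain U d where U: "orthogonal_matrix U" and A: "A = transpose U ** diag_matrix d ** U"
    and d: "\<And>i. 0 < d i"
    using pos_def_diagonalization[OF assms] by blast
  let ?D = "diag_matrix (\<lambda>i. sqrt (d i))"
  have "(transpose U ** ?D ** U) ** (transpose U ** ?D ** U)
      = transpose U ** (?D ** (U ** transpose U) ** ?D) ** U"
    by (simp add: matrix_mul_assoc)
  also have "\<dots> = A"
    using U d by (simp add: orthogonal_matrix_def diag_matrix_mult A less_imp_le)
  finally show ?thesis
    using pos_def_congruence[of ?D U] U d by (auto simp: pos_def_diag_matrix orthogonal_imp_invertible)
qed

text \<open>For \<open>D = R - S\<close> one has \<open>R D + D S = 0\<close>; testing this on a unit eigenvector of \<open>D\<close>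
  shows that its eigenvalue vanishes.\<close>

lemma pos_def_sqrt_unique:
  fixes R S :: "real ^ 'n ^ 'n"
  assumes R: "pos_def R" and S: "pos_def S" and eq: "R ** R = S ** S"
  shows "R = S"
proof -
  let ?D = "R - S"
  have sym: "transpose ?D = ?D"
    using R S by (simp add: pos_def_def transpose_def vec_eq_iff)
  then obtain U d where U: "orthogonal_matrix U" and D: "?D = transpose U ** diag_matrix d ** U"
    by (rule symmetric_matrix_diagonalization)
  \<comment> \<open>The mixed products cancel:
    \<open>R (R - S) + (R - S) S = R R - S S\<close>.\<close>
  have zero: "R *v (?D *v x) + ?D *v (S *v x) = 0" for x
    using arg_cong[OF eq, of "\<lambda>A. A *v x"]
    by (simp add: matrix_vector_mult_diff_rdistrib matrix_vector_mult_diff_distrib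
        flip: matrix_vector_mul_assoc)
  have "d i = 0" for i
  proof -
    \<comment> \<open>The column of \<open>transpose U\<close> that is the eigenvector of
      \<open>?D\<close> for \<open>d i\<close>.\<close>
    define v where "v = transpose U *v axis i 1"
    have "v \<noteq> 0"
      using U inj_matrix_vector_mult[of "transpose U"]
      by (metis axis_eq_0_iff injD matrix_vector_mult_0_right one_neq_zero orthogonal_imp_invertible
          orthogonal_matrix_transpose v_def)
    have "?D *v v = transpose U *v (diag_matrix d *v ((U ** transpose U) *v axis i 1))"
      by (simp only: D v_def matrix_vector_mul_assoc matrix_mul_assoc)
    also have "\<dots> = transpose U *v (d i *\<^sub>R axis i 1)"
    proof -
      have "diag_matrix d *v axis i 1 = d i *\<^sub>R axis i 1"
        by (simp add: diag_matrix_vector axis_def vec_eq_iff)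
      with U show ?thesis
        by (simp add: orthogonal_matrix_def)
    qed
    finally have Dv: "?D *v v = d i *\<^sub>R v"
      by (simp only: matrix_vector_mult_scaleR v_def)
    have "0 = v \<bullet> (R *v (?D *v v)) + v \<bullet> (?D *v (S *v v))"
      using zero[of v] by (simp flip: inner_add_right)
    also have "v \<bullet> (?D *v (S *v v)) = (?D *v v) \<bullet> (S *v v)"
      using inner_matrix_vector[of v ?D] sym by simp
    finally have "d i * (v \<bullet> (R *v v) + v \<bullet> (S *v v)) = 0"
      by (simp only: Dv matrix_vector_mult_scaleR inner_scaleR_left inner_scaleR_right distrib_left)
    moreover have "0 < v \<bullet> (R *v v) + v \<bullet> (S *v v)"
      using R S \<open>v \<noteq> 0\<close> by (simp add: pos_def_def add_pos_pos)
    ultimately show ?thesis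
      by simp
  qed
  then have "diag_matrix d = 0"
    by (simp add: diag_matrix_def vec_eq_iff)
  with D have "?D = 0"
    by (simp add: matrix_matrix_mult_def vec_eq_iff)
  then show ?thesis
    by simp
qed

lemma pd_sqrt:
  assumes "pos_def A"
  shows "pos_def (pd_sqrt A)" "pd_sqrt A ** pd_sqrt A = A"
proof -
  have "\<exists>!R. pos_def R \<and> R ** R = A"
    using pos_def_sqrt_exists[OF assms] by (auto intro: pos_def_sqrt_unique)
  from theI'[OF this] show "pos_def (pd_sqrt A)" "pd_sqrt A ** pd_sqrt A = A"
    by (auto simp: pd_sqrt_def)
qed

section \<open>Simultaneous diagonalization and strict determinant inequalities\<close>

text \<open>With \<open>R\<close> the square root of \<open>A\<close> and \<open>T\<close> its
  inverse, congruence by \<open>T\<close> turns \<open>A\<close> into the identity and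
  \<open>B\<close> into a symmetric matrix. An orthogonal \<open>U\<close> diagonalizing the latter
  leaves the identity fixed, so \<open>M = U ** R\<close> serves both.\<close>

lemma simultaneous_diagonalization:
  fixes A B :: "real ^ 'n ^ 'n"
  assumes A: "pos_def A" and B: "transpose B = B"
  obtains M :: "real ^ 'n ^ 'n" and d where "invertible M" "A = transpose M ** M" "B = transpose M ** diag_matrix d ** M"
proof -
  define R where "R = pd_sqrt A"
  have R: "pos_def R" "R ** R = A"
    unfolding R_def by (rule pd_sqrt[OF A])+
  define T where "T = matrix_inv R"
  have RT: "R ** T = mat 1" "T ** R = mat 1"
    unfolding T_def by (rule matrix_inv_invertible[OF pos_def_invertible[OF R(1)]])+
  have tR: "transpose R = R" and tT: "transpose T = T"
    using R(1) pos_def_inverse[OF R(1) RT(1)] by (simp_all add: pos_def_def)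
  have "transpose (T ** B ** T) = T ** B ** T"
    using B tT by (simp add: matrix_transpose_mul matrix_mul_assoc)
  then obtain U d where U: "orthogonal_matrix U" and TBT: "T ** B ** T = transpose U ** diag_matrix d ** U"
    by (rule symmetric_matrix_diagonalization)
  have "transpose (U ** R) ** (U ** R) = R ** (transpose U ** U) ** R"
    by (simp add: matrix_transpose_mul tR matrix_mul_assoc)
  also have "\<dots> = A"
    using U R by (simp add: orthogonal_matrix)
  finally have 1: "A = transpose (U ** R) ** (U ** R)" ..
  have "transpose (U ** R) ** diag_matrix d ** (U ** R) = R ** (transpose U ** diag_matrix d ** U) ** R"
    by (simp add: matrix_transpose_mul tR matrix_mul_assoc)
  also have "\<dots> = (R ** T) ** B ** (T ** R)"
    by (simp add: matrix_mul_assoc flip: TBT)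
  also have "\<dots> = B"
    by (simp add: RT)
  finally have 2: "B = transpose (U ** R) ** diag_matrix d ** (U ** R)" ..
  have "invertible (U ** R)"
    using U R by (intro invertible_mult orthogonal_imp_invertible pos_def_invertible)
  then show thesis
    using 1 2 by (rule that)
qed

lemma det_congruence_diag:
  fixes M :: "real ^ 'n ^ 'n"
  shows "det (transpose M ** diag_matrix d ** M) = (det M)\<^sup>2 * (\<Prod>i\<in>UNIV. d i)"
  by (simp add: det_mul det_diag_matrix power2_eq_square)

lemma matrix_add_rdistrib: "(B + C) ** A = B ** A + C ** A"
  by (vector matrix_matrix_mult_def sum.distrib[symmetric] field_simps)

lemma congruence_diag_add:
  fixes M :: "real ^ 'n ^ 'm"
  shows
  "transpose M ** M + transpose M ** diag_matrix d ** M = transpose M ** diag_matrix (\<lambda>i. 1 + d i) ** M"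
proof -
  have "diag_matrix (\<lambda>i. 1 + d i) = mat 1 + diag_matrix d"
    by (simp add: diag_matrix_add flip: diag_matrix_one)
  then show ?thesis
    by (simp add: matrix_add_ldistrib matrix_add_rdistrib)
qed

text \<open>In simultaneous diagonal form the determinant grows by the factor with terms
  \<open>1 + d i\<close>, where all \<open>d i\<close> are nonnegative and, as \<open>B\<close> is
  nonzero, not all vanish.\<close>

lemma det_add_pos_semidef_gt:
  fixes A B :: "real ^ 'n ^ 'n"
  assumes A: "pos_def A" and B: "transpose B = B" "\<And>x. 0 \<le> x \<bullet> (B *v x)" "B \<noteq> 0"
  shows "det A < det (A + B)"
proof -
  obtain M :: "real ^ 'n ^ 'n" and d where M: "invertible M" and Am: "A = transpose M ** M"
    and Bm: "B = transpose M ** diag_matrix d ** M"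
    using simultaneous_diagonalization[OF A B(1)] .
  have detM: "0 < (det M)\<^sup>2"
    using M by (simp add: invertible_det_nz)
  have d: "0 \<le> d i" for i
  proof -
    \<comment> \<open>At this \<open>x\<close> the quadratic form of \<open>B\<close> takes the
      value \<open>d i\<close>.\<close>
    obtain x where x: "M *v x = axis i 1"
      using M by (metis invertible_def matrix_vector_mul_assoc matrix_vector_mul_lid)
    have "0 \<le> x \<bullet> (B *v x)"
      by (rule B(2))
    also have "x \<bullet> (B *v x) = (M *v x) \<bullet> (diag_matrix d *v (M *v x))"
      by (simp only: Bm inner_matrix_vector[of x "transpose M"] transpose_transpose flip: matrix_vector_mul_assoc)
    finally show ?thesis
      by (simp add: x diag_matrix_vector inner_axis')
  qed
  have "\<exists>k. d k \<noteq> 0"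
  proof (rule ccontr)
    assume "\<nexists>k. d k \<noteq> 0"
    then have "diag_matrix d = 0"
      by (simp add: diag_matrix_def vec_eq_iff)
    with Bm B(3) show False
      by (simp add: matrix_matrix_mult_def vec_eq_iff)
  qed
  then obtain k where "0 < d k"
    using d by (metis less_eq_real_def)
  then have "1 < (\<Prod>i\<in>UNIV. 1 + d i)"
    using d by (intro less_1_prod2[where i = k]) auto
  then have "(det M)\<^sup>2 < (det M)\<^sup>2 * (\<Prod>i\<in>UNIV. 1 + d i)"
    using detM by simp
  also have "\<dots> = det (A + B)"
    by (simp add: Am Bm congruence_diag_add det_congruence_diag)
  finally show ?thesis
    by (simp add: Am det_mul power2_eq_square)
qed

text \<open>Strict AM-GM on each relative eigenvalue \<open>d i\<close>: \<open>4 d \<le> (1 + d)\<^sup>2\<close> with equality only for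
  \<open>d = 1\<close>.\<close>

lemma det_midpoint_gt:
  fixes A B :: "real ^ 'n ^ 'n"
  assumes A: "pos_def A" and B: "pos_def B" and det: "det A = det B" and ne: "A \<noteq> B"
  shows "det A < det ((1/2) *\<^sub>R (A + B))"
proof -
  have "transpose B = B"
    using B by (simp add: pos_def_def)
  then obtain M :: "real ^ 'n ^ 'n" and d where M: "invertible M" and Am: "A = transpose M ** M"
    and Bm: "B = transpose M ** diag_matrix d ** M"
    by (rule simultaneous_diagonalization[OF A])
  have detM: "0 < (det M)\<^sup>2"
    using M by (simp add: invertible_det_nz)
  have dA: "det A = (det M)\<^sup>2"
    by (simp add: Am det_mul power2_eq_square)
  \<comment> \<open>Congruence by the inverse \<open>N\<close> of \<open>M\<close> turns
    \<open>B\<close> into \<open>diag_matrix d\<close>, so its entries are positive.\<close>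
  obtain N where N: "M ** N = mat 1"
    using M by (auto simp: invertible_def)
  have "invertible N"
    using N by (metis invertible_def matrix_left_right_inverse)
  then have "pos_def (transpose N ** B ** N)"
    by (rule pos_def_congruence[OF B])
  also have "transpose N ** B ** N = transpose (M ** N) ** diag_matrix d ** (M ** N)"
    by (simp add: Bm matrix_transpose_mul matrix_mul_assoc)
  finally have d: "0 < d i" for i
    by (simp add: N pos_def_diag_matrix)
  \<comment> \<open>The equality of the determinants enters here: the relative eigenvalues have
    product one.\<close>
  have prod1: "(\<Prod>i\<in>UNIV. d i) = 1"
    using det detM by (simp add: dA Bm det_congruence_diag)
  have "\<exists>k. d k \<noteq> 1"
  proof (rule ccontr)
    assume "\<nexists>k. d k \<noteq> 1"
    then have "d = (\<lambda>_. 1)"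
      by auto
    then have "A = B"
      by (simp add: Am Bm diag_matrix_one)
    with ne show False ..
  qed
  then obtain k where k: "d k \<noteq> 1" ..
  have sq: "((1 + d i) / 2)\<^sup>2 = d i + ((1 - d i) / 2)\<^sup>2" for i
    by (simp add: power2_eq_square field_simps)
  have "(\<Prod>i\<in>UNIV. d i) < (\<Prod>i\<in>UNIV. ((1 + d i) / 2)\<^sup>2)"
    using d k unfolding sq
    by (intro prod_mono_strict[where i = k]) (auto simp: less_imp_le add_pos_nonneg)
  then have "1 < (\<Prod>i\<in>UNIV. (1 + d i) / 2)\<^sup>2"
    by (simp add: prod1 prod_power_distrib)
  then have "1 < (\<Prod>i\<in>UNIV. (1 + d i) / 2)"
    using d by (smt (verit) one_power2 power_mono prod_nonneg divide_nonneg_pos)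
  moreover have "(1/2) *\<^sub>R (A + B) = transpose M ** diag_matrix (\<lambda>i. (1 + d i) / 2) ** M"
  proof -
    have "diag_matrix (\<lambda>i. (1 + d i) / 2) = (1/2) *\<^sub>R diag_matrix (\<lambda>i. 1 + d i)"
      by (simp add: diag_matrix_def vec_eq_iff)
    then show ?thesis
      by (simp add: Am Bm congruence_diag_add matrix_scalar_ac scalar_matrix_assoc)
  qed
  ultimately show ?thesis
    using detM by (simp add: dA det_congruence_diag)
qed

subsection \<open>Positive John images\<close>

lemma measure_affine_image:
  fixes A :: "real ^ 'n ^ 'n"
  assumes "compact S"
  shows "measure lebesgue ((\<lambda>x. A *v x + w) ` S) = \<bar>det A\<bar> * measure lebesgue S"
proof -
  have "(\<lambda>x. A *v x + w) ` S = (+) w ` (*v) A ` S"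
    by (simp add: image_image add.commute)
  then show ?thesis
    by (simp only: measure_translation measure_matrix_image[OF assms])
qed

lemma convex_body_measure_pos: "convex_body K \<Longrightarrow> 0 < measure lebesgue K"
  unfolding convex_body_def
  by (metis less_eq_real_def lmeasurable_compact measure_nonneg negligible_convex_interior
      negligible_iff_measure0)

text \<open>Midpoints of corresponding points \<open>Q x + w\<close> and \<open>Q' x + w'\<close>
  stay in \<open>K\<close>. For positive definite \<open>Q\<close> and \<open>Q'\<close> this
  supplies the averaged competitor to which \<open>det_midpoint_gt\<close> applies.\<close>

lemma affine_image_midpoint_subset:
  fixes Q Q' :: "real ^ 'n ^ 'm"
  assumes K: "convex K" and Q: "(\<lambda>x. Q *v x + w) ` L \<subseteq> K" "(\<lambda>x. Q' *v x + w') ` L \<subseteq> K"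
  shows "(\<lambda>x. ((1/2) *\<^sub>R (Q + Q')) *v x + (1/2) *\<^sub>R (w + w')) ` L \<subseteq> K"
proof (rule image_subsetI)
  fix x assume "x \<in> L"
  then have "(1/2) *\<^sub>R (Q *v x + w) + (1/2) *\<^sub>R (Q' *v x + w') \<in> K"
    using Q by (intro convexD[OF K]) auto
  also have "(1/2) *\<^sub>R (Q *v x + w) + (1/2) *\<^sub>R (Q' *v x + w')
      = ((1/2) *\<^sub>R (Q + Q')) *v x + (1/2) *\<^sub>R (w + w')"
    by (simp add: matrix_vector_mult_add_rdistrib scaleR_add_right algebra_simps
        scaleR_matrix_vector_assoc)
  finally show "((1/2) *\<^sub>R (Q + Q')) *v x + (1/2) *\<^sub>R (w + w') \<in> K" .
qed

text \<open>A rank-one increment of \<open>Q\<close> in the direction \<open>u = w' - w\<close> moves each \<open>Q x + w\<close> along the segment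
  to \<open>Q x + w'\<close>.\<close>

lemma larger_positive_image_between_translates:
  fixes Q :: "real ^ 'n ^ 'n"
  assumes K: "convex K" and L: "bounded L" and Q: "pos_def Q" and ne: "w \<noteq> w'"
    and sub: "(\<lambda>x. Q *v x + w) ` L \<subseteq> K" "(\<lambda>x. Q *v x + w') ` L \<subseteq> K"
  obtains S v where "pos_def S" "det Q < det S" "(\<lambda>x. S *v x + v) ` L \<subseteq> K"
proof -
  define u where "u = w' - w"
  have u: "u \<noteq> 0"
    using ne by (simp add: u_def)
  obtain b where b: "0 < b" "\<And>x. x \<in> L \<Longrightarrow> norm x \<le> b"
    using L by (auto simp: bounded_pos)
  \<comment> \<open>Scaled so that \<open>c * (u \<bullet> x)\<close> stays within 1/2 of zero on
    \<open>L\<close>.\<close>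
  define c where "c = 1 / (2 * (norm u * b))"
  have c: "0 < c"
    using u b by (simp add: c_def)
  have cx: "\<bar>c * (u \<bullet> x)\<bar> \<le> 1/2" if "x \<in> L" for x
  proof -
    have "\<bar>u \<bullet> x\<bar> \<le> norm u * b"
      using Cauchy_Schwarz_ineq2[of u x] b(2)[OF that]
      by (meson mult_left_mono norm_ge_zero order_trans)
    then show ?thesis
      using u b by (simp add: c_def divide_simps abs_mult)
  qed
  define E :: "real ^ 'n ^ 'n" where "E = (\<chi> i j. c * u $ i * u $ j)"
  have Ev: "E *v x = (c * (u \<bullet> x)) *\<^sub>R u" for x
    by (simp add: E_def vec_eq_iff matrix_vector_mult_def inner_vec_def sum_distrib_left sum_distrib_right
        mult_ac)
  have E: "transpose E = E" "\<And>x. 0 \<le> x \<bullet> (E *v x)"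
    using c by (simp_all add: Ev inner_commute[of _ u] mult.assoc, simp add: E_def transpose_def vec_eq_iff)
  have "E *v u \<noteq> 0"
    using c u by (simp add: Ev)
  then have "E \<noteq> 0"
    by auto
  show thesis
  \<comment> \<open>The shift by half of \<open>u\<close> centres the range of displacements:
    \<open>x\<close> is moved by \<open>c * (u \<bullet> x) + 1/2\<close> times \<open>u\<close>, a
    fraction between 0 and 1.\<close>
  proof (rule that[of "Q + E" "w + (1/2) *\<^sub>R u"])
    show "pos_def (Q + E)"
      using Q E
      by (auto simp: pos_def_def matrix_vector_mult_add_rdistrib inner_add_right add_pos_nonneg
          transpose_def vec_eq_iff)
    show "det Q < det (Q + E)"
      using det_add_pos_semidef_gt[OF Q E \<open>E \<noteq> 0\<close>] .
    show "(\<lambda>x. (Q + E) *v x + (w + (1/2) *\<^sub>R u)) ` L \<subseteq> K"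
    proof (rule image_subsetI)
      fix x assume x: "x \<in> L"
      define s where "s = c * (u \<bullet> x) + 1/2"
      have "0 \<le> s" "s \<le> 1"
        using cx[OF x] by (auto simp: s_def abs_le_iff)
      then have "(1 - s) *\<^sub>R (Q *v x + w) + s *\<^sub>R (Q *v x + w') \<in> K"
        using sub x by (intro convexD[OF K]) auto
      also have "(1 - s) *\<^sub>R (Q *v x + w) + s *\<^sub>R (Q *v x + w') = Q *v x + w + s *\<^sub>R u"
        by (simp add: u_def algebra_simps)
      also have "\<dots> = (Q + E) *v x + (w + (1/2) *\<^sub>R u)"
        by (simp add: s_def Ev matrix_vector_mult_add_rdistrib scaleR_add_left)
      finally show "(Q + E) *v x + (w + (1/2) *\<^sub>R u) \<in> K" .
    qed
  qed
qed

text \<open>Every positive image has volume \<open>det S\<close> times that of \<open>L\<close>,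
  which is positive, so maximality of volume is maximality of the determinant. Averaging then forces
  equal linear parts, and stretching between translates forces equal translation vectors.\<close>

lemma max_positive_image_unique:
  assumes K: "convex K" and L: "convex_body L"
    and M: "max_positive_image_in L K M" and N: "max_positive_image_in L K N"
  shows "M = N"
proof -
  have Lc: "compact L"
    using L by (simp add: convex_body_def)
  have vol: "measure lebesgue ((\<lambda>x. S *v x + v) ` L) = det S * measure lebesgue L"
    if "pos_def S" for S v
    using pos_def_det_pos[OF that] by (simp add: measure_affine_image[OF Lc])
  obtain Q w where Q: "pos_def Q" "M = (\<lambda>x. Q *v x + w) ` L" "M \<subseteq> K"
    using M by (auto simp: max_positive_image_in_def positive_image_in_def)
  obtain Q' w' where Q': "pos_def Q'" "N = (\<lambda>x. Q' *v x + w') ` L" "N \<subseteq> K"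
    using N by (auto simp: max_positive_image_in_def positive_image_in_def)
  have max: "det S \<le> det Q" if "pos_def S" "(\<lambda>x. S *v x + v) ` L \<subseteq> K" for S v
  proof -
    have "positive_image_in L K ((\<lambda>x. S *v x + v) ` L)"
      using that unfolding positive_image_in_def by blast
    then have "measure lebesgue ((\<lambda>x. S *v x + v) ` L) \<le> measure lebesgue M"
      using M by (simp add: max_positive_image_in_def)
    then show ?thesis
      using that Q convex_body_measure_pos[OF L] by (simp add: vol)
  qed
  have "measure lebesgue M = measure lebesgue N"
    using M N by (simp add: max_positive_image_in_def order_antisym)
  then have det: "det Q = det Q'"
    using Q Q' convex_body_measure_pos[OF L] by (simp add: vol)
  have QQ': "Q = Q'"
  proof (rule ccontr)
    assume "Q \<noteq> Q'"
    then have "det Q < det ((1/2) *\<^sub>R (Q + Q'))"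
      using det_midpoint_gt Q Q' det by blast
    moreover have "det ((1/2) *\<^sub>R (Q + Q')) \<le> det Q"
      using Q Q'
      by (intro max[OF _ affine_image_midpoint_subset[OF K]] pos_def_scaleR pos_def_add) auto
    ultimately show False
      by simp
  qed
  have "w = w'"
  proof (rule ccontr)
    assume "w \<noteq> w'"
    then obtain S v where "pos_def S" "det Q < det S" "(\<lambda>x. S *v x + v) ` L \<subseteq> K"
      using larger_positive_image_between_translates[OF K compact_imp_bounded[OF Lc] Q(1)]
        Q Q' QQ' by metis
    with max show False
      by fastforce
  qed
  with QQ' Q Q' show ?thesis
    by simp
qed

section \<open>Transfer of maximality along the inverse square root\<close>

text \<open>The left factor of \<open>T ** Q ** T\<close> moves the image into \<open>T K\<close>,
  while the right one undoes \<open>R\<close>, so that the linear part stays positive definite. The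
  offset \<open>v\<close> is kept arbitrary so that the lemma also applies in the reverse direction,
  with \<open>R\<close> and \<open>T\<close> exchanged.\<close>

lemma positive_image_in_congruence:
  fixes R T :: "real ^ 'n ^ 'n"
  assumes T: "pos_def T" and TR: "T ** R = mat 1" and N: "positive_image_in L K N"
  shows "positive_image_in ((\<lambda>x. R *v x + v) ` L) ((*v) T ` K) ((*v) T ` N)"
proof -
  obtain Q w where Q: "pos_def Q" "N = (\<lambda>x. Q *v x + w) ` L" "N \<subseteq> K"
    using N by (auto simp: positive_image_in_def)
  let ?S = "T ** Q ** T"
  have "pos_def ?S"
    using pos_def_congruence[OF Q(1) pos_def_invertible[OF T]] T by (simp add: pos_def_def)
  moreover have "?S *v (R *v x + v) + (T *v w - ?S *v v) = T *v (Q *v x + w)" for x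
  proof -
    have "?S *v (R *v x) = (T ** Q ** (T ** R)) *v x"
      by (simp only: matrix_vector_mul_assoc matrix_mul_assoc)
    then show ?thesis
      by (simp add: TR matrix_vector_right_distrib matrix_vector_mul_assoc)
  qed
  then have "(*v) T ` N = (\<lambda>y. ?S *v y + (T *v w - ?S *v v)) ` (\<lambda>x. R *v x + v) ` L"
    by (simp add: Q(2) image_image)
  moreover have "(*v) T ` N \<subseteq> (*v) T ` K"
    using Q(3) by blast
  ultimately show ?thesis
    unfolding positive_image_in_def by blast
qed

lemma max_positive_image_in_iff_position:
  assumes L: "compact L" and P: "pos_def P"
  shows "max_positive_image_in L K ((\<lambda>x. P *v x + z) ` L) \<longleftrightarrow>
    positive_John_position
      ((\<lambda>x. pd_sqrt P *v x + pd_inv_sqrt P *v z) ` L)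
      ((\<lambda>x. pd_inv_sqrt P *v x) ` K)"
proof -
  define R T where "R = pd_sqrt P" and "T = pd_inv_sqrt P"
  have R: "pos_def R" "R ** R = P"
    unfolding R_def by (rule pd_sqrt[OF P])+
  have RT: "R ** T = mat 1" "T ** R = mat 1"
    unfolding T_def pd_inv_sqrt_def R_def[symmetric]
    by (rule matrix_inv_invertible[OF pos_def_invertible[OF R(1)]])+
  have T: "pos_def T"
    by (rule pos_def_inverse[OF R(1) RT(1)])
  have TR_image: "(*v) T ` (*v) R ` X = X" and RT_image: "(*v) R ` (*v) T ` X = X" for X
    by (simp_all add: image_image matrix_vector_mul_assoc RT)
  define L' where "L' = (\<lambda>x. R *v x + T *v z) ` L"
  define K' where "K' = (*v) T ` K"
  define M where "M = (\<lambda>x. P *v x + z) ` L"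
  have RL': "(*v) R ` L' = M"
    by (simp add: L'_def M_def image_image matrix_vector_right_distrib matrix_vector_mul_assoc R RT)
  have RK': "(*v) R ` K' = K"
    by (simp add: K'_def RT_image)
  have L'c: "compact L'"
    unfolding L'_def by (intro compact_continuous_image continuous_intros L matrix_vector_mult_linear_continuous_on)
  \<comment> \<open>The affine map defining \<open>L'\<close> is inverted here, which puts
    \<open>L\<close> into the form required for the reverse transfer.\<close>
  have L_eq: "L = (\<lambda>x. T *v x + - (T *v (T *v z))) ` L'"
    by (simp add: L'_def image_image matrix_vector_right_distrib matrix_vector_mul_assoc RT)
  have fwd: "positive_image_in L' K' ((*v) T ` N)" if "positive_image_in L K N" for N
    unfolding L'_def K'_def by (rule positive_image_in_congruence[OF T RT(2) that])
  have bwd: "positive_image_in L K ((*v) R ` N)" if "positive_image_in L' K' N" for N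
    using positive_image_in_congruence[OF R(1) RT(1) that, of "- (T *v (T *v z))"]
    by (simp only: RK' flip: L_eq)
  have compact_image: "compact N" if "positive_image_in A B N" "compact A" for A B N
    using that unfolding positive_image_in_def
    by (auto intro!: compact_continuous_image continuous_intros matrix_vector_mult_linear_continuous_on)
  have vol: "measure lebesgue ((*v) R ` N) = det R * measure lebesgue N" if "compact N" for N
    using measure_matrix_image[OF that, of R] pos_def_det_pos[OF R(1)] by simp
  have subset: "M \<subseteq> K \<longleftrightarrow> L' \<subseteq> K'"
    using RL' RK' TR_image by (metis image_mono)
  have M: "positive_image_in L K M \<longleftrightarrow> M \<subseteq> K"
    using P unfolding positive_image_in_def M_def by blast
  have "(\<forall>N. positive_image_in L K N \<longrightarrow> measure lebesgue N \<le> measure lebesgue M) \<longleftrightarrow>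
    (\<forall>N. positive_image_in L' K' N \<longrightarrow> measure lebesgue N \<le> measure lebesgue L')"
  proof -
    \<comment> \<open>Since \<open>M\<close> is the image of \<open>L'\<close> under
      \<open>R\<close>, both volumes on the left carry the same positive factor
      \<open>det R\<close>.\<close>
    have "measure lebesgue ((*v) R ` N) \<le> measure lebesgue M \<longleftrightarrow> measure lebesgue N \<le> measure lebesgue L'"
      if "positive_image_in L' K' N" for N
      using vol[OF compact_image[OF that L'c]] vol[OF L'c] pos_def_det_pos[OF R(1)]
      by (simp add: RL')
    then show ?thesis
      using fwd bwd RT_image by metis
  qed
  then show ?thesis
    using subset M
    by (simp add: max_positive_image_in_def positive_John_position_def R_def T_def L'_def K'_def M_def)
qed

theorem proposition3p2:
  fixes K L :: "(real ^ 'n) set" and P :: "real ^ 'n ^ 'n" and z :: "real ^ 'n"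
  assumes "convex_body K" and "convex_body L" and "pos_def P"
  shows "positive_John_image L K ((\<lambda>x. P *v x + z) ` L) \<longleftrightarrow>
    positive_John_position
      ((\<lambda>x. pd_sqrt P *v x + pd_inv_sqrt P *v z) ` L)
      ((\<lambda>x. pd_inv_sqrt P *v x) ` K)"
proof -
  have "compact L" "convex K"
    using assms by (auto simp: convex_body_def)
  \<comment> \<open>The uniqueness clause of \<open>positive_John_image\<close> follows from
    maximality for these bodies, so only maximality has to be transferred.\<close>
  have "positive_John_image L K M \<longleftrightarrow> max_positive_image_in L K M" for M
    using max_positive_image_unique[OF \<open>convex K\<close> assms(2)] by (auto simp: positive_John_image_def)
  then show ?thesis
    using max_positive_image_in_iff_position[OF \<open>compact L\<close> assms(3)] by simp
qed

end
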